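(* Let $n\in\{1,\dots,N\}$, fix $E_u>0$, $\tau>0$ and $\kappa\in[0,1]$, and set $p_u=E_u/M$, $p_p=\tau p_u$, $M_0=\kappa M$, $M_1=(1-\kappa)M$, with all other parameters ($N$, $\rho$, $\alpha$, $\beta_i$, $K_i$, $\theta_i$, $k$, $d$) fixed. Then the closed-form approximate uplink achievable rate $R_{\mathrm{IP},n}$ of user $n$ (MRC receiver, imperfect CSI) given in the context satisfies $$R_{\mathrm{IP},n}\to L(K_n):=\log_2\left(1+\frac{(\rho\kappa+\alpha)E_u\beta_nK_n}{K_n+1}\right)\qquad\text{as } M\to\infty.$$ Moreover $L(K_n)\to\log_2\left(1+E_u\beta_n(\rho\kappa+\alpha)\right)$ as $K_n\to\infty$, and (with $\rho=1-\alpha$) $L(K_n)$ is monotonically increasing (non-decreasing) in $\kappa$ and in $\alpha$.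
   Context: Parameters of a mixed-ADC massive MIMO uplink: $N\ge 1$ users; $M=M_0+M_1$ base-station antennas, $M_0$ with high-resolution ADCs and $M_1$ with low-resolution ADCs, $\kappa=M_0/M$ (in the formulas below $M_0,M_1$ may be treated as nonnegative real numbers); distortion factor $\rho\in[0,1)$ of the low-resolution ADCs and $\alpha=1-\rho$; transmit power $p_u>0$; pilot power $p_p=\tau p_u$ with $\tau$ pilot symbols; large-scale fading coefficients $\beta_i>0$; Rician factors $K_i\ge 0$; arrival angles $\theta_i\in\mathbb{R}$; real constants $k,d>0$ (only the product $kd$ matters). For $i\neq n$ and $j=0,1$ put $$\phi_{ni,j}=\frac{\sin\left(M_j kd(\sin\theta_n-\sin\theta_i)/2\right)}{\sin\left(kd(\sin\theta_n-\sin\theta_i)/2\right)},$$ where it is assumed that $\sin\left(kd(\sin\theta_n-\sin\theta_i)/2\right)\ne 0$ for all $i\ne n$, so that these are defined. For every $i=1,\dots,N$ put $$\eta_i=\frac{p_p\beta_i}{1+p_p\beta_i},\qquad \sigma_i^2=\frac{\beta_i}{(1+p_p\beta_i)(K_i+1)},$$ and $$\Delta_3^{(i)}=\frac{\beta_i}{K_i+1}K_nK_i\left(\phi_{ni,0}^2+\alpha^2\phi_{ni,1}^2\right)+\frac{\beta_i(M_0+\alpha^2M_1)}{K_i+1}\left(K_i\eta_n+K_n\eta_i+\eta_n\eta_i\right)\quad(i\ne n),$$ $$\Delta_4=\beta_n\left(K_n^2+4K_n\eta_n+2\eta_n^2\right)+(K_n+1)(K_n+\eta_n)\sum_{i\ne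 n}\frac{\beta_i(K_i+\eta_i)}{K_i+1}.$$ The closed-form approximate rate is $R_{\mathrm{IP},n}=\log_2(1+A/B)$ with $$A=p_u\beta_n\left[(M_0+\alpha M_1)^2(K_n+\eta_n)^2+(M_0+\alpha^2M_1)(\eta_n^2+2K_n\eta_n)\right],$$ $$B=(M_0+\alpha M_1)(K_n+\eta_n)(K_n+1)\left(1+p_u\sum_{i=1}^N\sigma_i^2\right)+p_u(K_n+1)\sum_{i\ne n}\Delta_3^{(i)}+\alpha\rho p_uM_1\Delta_4.$$ *)

theory Defs
  imports Complex_Main
begin

text \<open>
  Users are indexed by \<open>{1..N}\<close>; \<open>n\<close> is the user of interest and \<open>\<beta>\<close>, \<open>K\<close>, \<open>\<theta>\<close> map a user to its
  large-scale fading coefficient, Rician factor and arrival angle. The numbers of antennas with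
  high- and low-resolution ADCs, \<open>M0\<close> and \<open>M1\<close>, are real. The relation \<open>\<alpha> = 1 - \<rho>\<close>
  is not built into the definitions.
\<close>

definition phi :: "real \<Rightarrow> real \<Rightarrow> (nat \<Rightarrow> real) \<Rightarrow> real \<Rightarrow> nat \<Rightarrow> nat \<Rightarrow> real" where
  "phi k d \<theta> Mj n i =
     sin (Mj * (k * d) * (sin (\<theta> n) - sin (\<theta> i)) / 2) /
     sin (k * d * (sin (\<theta> n) - sin (\<theta> i)) / 2)"

definition eta :: "real \<Rightarrow> (nat \<Rightarrow> real) \<Rightarrow> nat \<Rightarrow> real" where
  "eta pp \<beta> i = pp * \<beta> i / (1 + pp * \<beta> i)"

definition sigma_sq :: "real \<Rightarrow> (nat \<Rightarrow> real) \<Rightarrow> (nat \<Rightarrow> real) \<Rightarrow> nat \<Rightarrow> real" where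
  "sigma_sq pp \<beta> K i = \<beta> i / ((1 + pp * \<beta> i) * (K i + 1))"

definition Delta3 :: "real \<Rightarrow> real \<Rightarrow> (nat \<Rightarrow> real) \<Rightarrow> real \<Rightarrow> real \<Rightarrow> real \<Rightarrow> real \<Rightarrow>
    (nat \<Rightarrow> real) \<Rightarrow> (nat \<Rightarrow> real) \<Rightarrow> nat \<Rightarrow> nat \<Rightarrow> real" where
  "Delta3 k d \<theta> \<alpha> M0 M1 pp \<beta> K n i =
     \<beta> i / (K i + 1) * K n * K i *
       ((phi k d \<theta> M0 n i)\<^sup>2 + \<alpha>\<^sup>2 * (phi k d \<theta> M1 n i)\<^sup>2) +
     \<beta> i * (M0 + \<alpha>\<^sup>2 * M1) / (K i + 1) *
       (K i * eta pp \<beta> n + K n * eta pp \<beta> i + eta pp \<beta> n * eta pp \<beta> i)"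

definition Delta4 :: "nat \<Rightarrow> real \<Rightarrow> (nat \<Rightarrow> real) \<Rightarrow> (nat \<Rightarrow> real) \<Rightarrow> nat \<Rightarrow> real" where
  "Delta4 N pp \<beta> K n =
     \<beta> n * ((K n)\<^sup>2 + 4 * K n * eta pp \<beta> n + 2 * (eta pp \<beta> n)\<^sup>2) +
     (K n + 1) * (K n + eta pp \<beta> n) *
       (\<Sum>i\<in>{1..N} - {n}. \<beta> i * (K i + eta pp \<beta> i) / (K i + 1))"

definition rate_num :: "real \<Rightarrow> real \<Rightarrow> real \<Rightarrow> real \<Rightarrow> real \<Rightarrow>
    (nat \<Rightarrow> real) \<Rightarrow> (nat \<Rightarrow> real) \<Rightarrow> nat \<Rightarrow> real" where
  "rate_num \<alpha> M0 M1 pu pp \<beta> K n =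
     pu * \<beta> n *
       ((M0 + \<alpha> * M1)\<^sup>2 * (K n + eta pp \<beta> n)\<^sup>2 +
        (M0 + \<alpha>\<^sup>2 * M1) * ((eta pp \<beta> n)\<^sup>2 + 2 * K n * eta pp \<beta> n))"

definition rate_den :: "nat \<Rightarrow> real \<Rightarrow> real \<Rightarrow> (nat \<Rightarrow> real) \<Rightarrow> real \<Rightarrow> real \<Rightarrow> real \<Rightarrow> real \<Rightarrow>
    real \<Rightarrow> real \<Rightarrow> (nat \<Rightarrow> real) \<Rightarrow> (nat \<Rightarrow> real) \<Rightarrow> nat \<Rightarrow> real" where
  "rate_den N k d \<theta> \<rho> \<alpha> M0 M1 pu pp \<beta> K n =
     (M0 + \<alpha> * M1) * (K n + eta pp \<beta> n) * (K n + 1) *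
       (1 + pu * (\<Sum>i\<in>{1..N}. sigma_sq pp \<beta> K i)) +
     pu * (K n + 1) * (\<Sum>i\<in>{1..N} - {n}. Delta3 k d \<theta> \<alpha> M0 M1 pp \<beta> K n i) +
     \<alpha> * \<rho> * pu * M1 * Delta4 N pp \<beta> K n"

definition rate_IP :: "nat \<Rightarrow> real \<Rightarrow> real \<Rightarrow> (nat \<Rightarrow> real) \<Rightarrow> real \<Rightarrow> real \<Rightarrow> real \<Rightarrow> real \<Rightarrow>
    real \<Rightarrow> real \<Rightarrow> (nat \<Rightarrow> real) \<Rightarrow> (nat \<Rightarrow> real) \<Rightarrow> nat \<Rightarrow> real" where
  "rate_IP N k d \<theta> \<rho> \<alpha> M0 M1 pu pp \<beta> K n =
     log 2 (1 + rate_num \<alpha> M0 M1 pu pp \<beta> K n /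
                rate_den N k d \<theta> \<rho> \<alpha> M0 M1 pu pp \<beta> K n)"

text \<open>The limit rate \<open>L\<close>; the last two arguments are \<open>\<beta>\<^sub>n\<close> and \<open>K\<^sub>n\<close>.\<close>

definition rate_limit :: "real \<Rightarrow> real \<Rightarrow> real \<Rightarrow> real \<Rightarrow> real \<Rightarrow> real \<Rightarrow> real" where
  "rate_limit \<rho> \<alpha> \<kappa> Eu b x = log 2 (1 + (\<rho> * \<kappa> + \<alpha>) * Eu * b * x / (x + 1))"

end

theory Submission
  imports Defs
begin

text \<open>
  As \<open>M\<close> grows, every \<open>\<eta>\<^sub>i\<close> vanishes like \<open>1 / M\<close> and every \<open>\<phi>\<^sub>n\<^sub>i\<close> stays bounded. If \<open>K\<^sub>n > 0\<close>, numerator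
  and denominator are both of order \<open>M\<close>. If \<open>K\<^sub>n = 0\<close>, the denominator converges to a positive
  number because \<open>M \<eta>\<^sub>n\<close> does, whereas the numerator is of order \<open>1 / M\<close>. The number \<open>\<rho>\<kappa> + \<alpha>\<close> enters as
  \<open>(M\<^sub>0 + \<alpha> M\<^sub>1) / M\<close>.
\<close>

lemma eta_tendsto_0: "((\<lambda>M::real. eta (c / M) \<beta> i) \<longlongrightarrow> 0) at_top"
proof -
  have "((\<lambda>M::real. (c / M) * \<beta> i / (1 + (c / M) * \<beta> i)) \<longlongrightarrow> 0 * \<beta> i / (1 + 0 * \<beta> i)) at_top"
    by (intro tendsto_intros tendsto_divide_0[OF tendsto_const] filterlim_ident
        filterlim_at_top_imp_at_infinity) auto
  then show ?thesis
    by (simp add: eta_def)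
qed

text \<open>The factor \<open>M\<close> cancels the \<open>1 / M\<close> in the numerator of
  \<open>eta\<close>. This exact first-order rate gives the leading term of the denominator when
  \<open>K n = 0\<close>.\<close>

lemma mult_eta_tendsto: "((\<lambda>M::real. M * eta (c / M) \<beta> i) \<longlongrightarrow> c * \<beta> i) at_top"
proof -
  have "((\<lambda>M::real. c * \<beta> i / (1 + (c / M) * \<beta> i)) \<longlongrightarrow> c * \<beta> i / (1 + 0 * \<beta> i)) at_top"
    by (intro tendsto_intros tendsto_divide_0[OF tendsto_const] filterlim_ident
        filterlim_at_top_imp_at_infinity) auto
  moreover have "\<forall>\<^sub>F M::real in at_top. c * \<beta> i / (1 + (c / M) * \<beta> i) = M * eta (c / M) \<beta> i"
    using eventually_gt_at_top[of 0] by eventually_elim (simp add: eta_def)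
  ultimately show ?thesis
    by (rule tendsto_eq_rhs[OF Lim_transform_eventually]) simp
qed

lemma sigma_sq_tendsto:
  "((\<lambda>M::real. sigma_sq (c / M) \<beta> K i) \<longlongrightarrow> \<beta> i / (K i + 1)) at_top" if "K i \<ge> 0"
proof -
  have "((\<lambda>M::real. \<beta> i / ((1 + (c / M) * \<beta> i) * (K i + 1)))
      \<longlongrightarrow> \<beta> i / ((1 + 0 * \<beta> i) * (K i + 1))) at_top"
    using that
    by (intro tendsto_intros tendsto_divide_0[OF tendsto_const] filterlim_ident
        filterlim_at_top_imp_at_infinity) auto
  then show ?thesis
    by (simp add: sigma_sq_def)
qed

lemma phi_sq_le: "(phi k d \<theta> m n i)\<^sup>2 \<le> 1 / (sin (k * d * (sin (\<theta> n) - sin (\<theta> i)) / 2))\<^sup>2"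
proof -
  have "(sin (m * (k * d) * (sin (\<theta> n) - sin (\<theta> i)) / 2))\<^sup>2 \<le> 1"
    by (simp add: abs_square_le_1)
  then show ?thesis
    \<comment> \<open>Where the sine in the denominator vanishes, both sides are 0 because
      \<open>x / 0 = 0\<close>.\<close>
    by (simp add: phi_def power_divide divide_right_mono)
qed

lemma phi_sq_divide_tendsto_0:
  "((\<lambda>M::real. (phi k d \<theta> (c * M) n i)\<^sup>2 / M) \<longlongrightarrow> 0) at_top"
\<comment> \<open>The sine in the numerator oscillates with \<open>M\<close>, so the quotient is
  squeezed using the bound of \<open>phi_sq_le\<close>, which is uniform in
  \<open>M\<close>.\<close>
proof (rule tendsto_sandwich[OF _ _ tendsto_const])
  let ?C = "1 / (sin (k * d * (sin (\<theta> n) - sin (\<theta> i)) / 2))\<^sup>2"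
  show "\<forall>\<^sub>F M::real in at_top. 0 \<le> (phi k d \<theta> (c * M) n i)\<^sup>2 / M"
    using eventually_gt_at_top[of 0] by eventually_elim simp
  show "\<forall>\<^sub>F M::real in at_top. (phi k d \<theta> (c * M) n i)\<^sup>2 / M \<le> ?C / M"
    using eventually_gt_at_top[of 0] by eventually_elim (intro divide_right_mono phi_sq_le; simp)
  show "((\<lambda>M::real. ?C / M) \<longlongrightarrow> 0) at_top"
    by (intro tendsto_divide_0[OF tendsto_const] filterlim_ident filterlim_at_top_imp_at_infinity)
qed

text \<open>The first summand is bounded, so division by \<open>M\<close> kills it. In the second,
  the division turns the antenna count into a constant, and every product in the remaining bracket
  contains an \<open>eta\<close>.\<close>

lemma Delta3_divide_tendsto_0:
  "((\<lambda>M::real. Delta3 k d \<theta> \<alpha> (a * M) (b * M) (c / M) \<beta> K n i / M) \<longlongrightarrow> 0) at_top"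
proof -
  let ?f = "\<lambda>M::real. \<beta> i / (K i + 1) * K n * K i *
       ((phi k d \<theta> (a * M) n i)\<^sup>2 / M + \<alpha>\<^sup>2 * ((phi k d \<theta> (b * M) n i)\<^sup>2 / M)) +
     \<beta> i * (a + \<alpha>\<^sup>2 * b) / (K i + 1) *
       (K i * eta (c / M) \<beta> n + K n * eta (c / M) \<beta> i + eta (c / M) \<beta> n * eta (c / M) \<beta> i)"
  have "(?f \<longlongrightarrow> \<beta> i / (K i + 1) * K n * K i * (0 + \<alpha>\<^sup>2 * 0) +
      \<beta> i * (a + \<alpha>\<^sup>2 * b) / (K i + 1) * (K i * 0 + K n * 0 + 0 * 0)) at_top"
    by (intro tendsto_add tendsto_mult tendsto_const phi_sq_divide_tendsto_0 eta_tendsto_0)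
  moreover have "\<forall>\<^sub>F M::real in at_top.
      ?f M = Delta3 k d \<theta> \<alpha> (a * M) (b * M) (c / M) \<beta> K n i / M"
    using eventually_gt_at_top[of 0]
  proof eventually_elim
    case (elim M)
    \<comment> \<open>The two equations pull the division by \<open>M\<close> out of the two
      summands of \<open>?f M\<close>; the second needs \<open>M\<close> nonzero for
      cancellation.\<close>
    have 1: "C * (x / M + \<alpha>\<^sup>2 * (y / M)) = C * (x + \<alpha>\<^sup>2 * y) / M" for C x y
      by (simp add: distrib_left add_divide_distrib)
    have 2: "\<beta> i * (a + \<alpha>\<^sup>2 * b) / (K i + 1) * z
        = \<beta> i * (a * M + \<alpha>\<^sup>2 * (b * M)) / (K i + 1) * z / M" for z
    proof -
      have "a * M + \<alpha>\<^sup>2 * (b * M) = (a + \<alpha>\<^sup>2 * b) * M"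
        by algebra
      then show ?thesis
        using elim by simp
    qed
    show ?case
      unfolding Delta3_def 1 2 add_divide_distrib ..
  qed
  ultimately show ?thesis
    by (rule tendsto_eq_rhs[OF Lim_transform_eventually]) simp
qed

lemma Delta4_tendsto:
  "((\<lambda>M::real. Delta4 N (c / M) \<beta> K n) \<longlongrightarrow>
     \<beta> n * (K n)\<^sup>2 + (K n + 1) * K n * (\<Sum>i\<in>{1..N} - {n}. \<beta> i * K i / (K i + 1))) at_top"
  if "\<And>i. i \<in> {1..N} \<Longrightarrow> K i \<ge> 0"
proof -
  have "((\<lambda>M::real. Delta4 N (c / M) \<beta> K n) \<longlongrightarrow>
     \<beta> n * ((K n)\<^sup>2 + 4 * K n * 0 + 2 * 0\<^sup>2) + (K n + 1) * (K n + 0) *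
       (\<Sum>i\<in>{1..N} - {n}. \<beta> i * (K i + 0) / (K i + 1))) at_top"
    unfolding Delta4_def
    by (intro tendsto_intros eta_tendsto_0) (use that in force)
  then show ?thesis
    by simp
qed

text \<open>Here \<open>a\<close> and \<open>b\<close> are the fractions of high- and low-resolution
  antennas. With \<open>c = a + \<alpha> * b\<close> and \<open>K n > 0\<close>, the leading terms
  are \<open>Eu * \<beta> n * (c * K n)\<^sup>2 * M\<close> and
  \<open>c * K n * (K n + 1) * M\<close>; \<open>c > 0\<close> keeps the second one
  positive.\<close>

lemma rate_ratio_tendsto:
  fixes \<beta> K \<theta> :: "nat \<Rightarrow> real"
  assumes n: "n \<in> {1..N}" and \<beta>: "\<beta> n > 0"
    and K: "\<And>i. i \<in> {1..N} \<Longrightarrow> K i \<ge> 0"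
    and Eu: "Eu > 0" and \<tau>: "\<tau> > 0" and ab: "a + \<alpha> * b > 0"
  shows "((\<lambda>M::real. rate_num \<alpha> (a * M) (b * M) (Eu / M) (\<tau> * (Eu / M)) \<beta> K n /
      rate_den N k d \<theta> \<rho> \<alpha> (a * M) (b * M) (Eu / M) (\<tau> * (Eu / M)) \<beta> K n)
      \<longlongrightarrow> (a + \<alpha> * b) * Eu * \<beta> n * K n / (K n + 1)) at_top"
proof -
  define \<eta> where "\<eta> M = eta (\<tau> * Eu / M) \<beta> n" for M
  define c where "c = a + \<alpha> * b"
  define S where "S M = (\<Sum>i\<in>{1..N}. sigma_sq (\<tau> * Eu / M) \<beta> K i)" for M
  \<comment> \<open>The last two summands of the denominator, with the \<open>1 / M\<close> of the
    transmit power already absorbed, so that \<open>T\<close> stays bounded.\<close>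
  define T where "T M = (K n + 1) * Eu *
      (\<Sum>i\<in>{1..N} - {n}. Delta3 k d \<theta> \<alpha> (a * M) (b * M) (\<tau> * Eu / M) \<beta> K n i / M)
      + \<alpha> * \<rho> * Eu * b * Delta4 N (\<tau> * Eu / M) \<beta> K n" for M
  define A where "A M = rate_num \<alpha> (a * M) (b * M) (Eu / M) (\<tau> * (Eu / M)) \<beta> K n" for M
  define B where
    "B M = rate_den N k d \<theta> \<rho> \<alpha> (a * M) (b * M) (Eu / M) (\<tau> * (Eu / M)) \<beta> K n" for M
  \<comment> \<open>For \<open>K n > 0\<close>, \<open>T\<close> gets divided by \<open>M\<close>,
    and any finite limit will do. For \<open>K n = 0\<close> it stands next to a bounded leading
    term; its limit is then 0 since both terms in the limit of \<open>Delta4\<close> contain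
    \<open>K n\<close>.\<close>
  obtain D where D: "(T \<longlongrightarrow> D) at_top" and D0: "K n = 0 \<Longrightarrow> D = 0"
  proof
    show "(T \<longlongrightarrow> (K n + 1) * Eu * (\<Sum>i\<in>{1..N} - {n}. 0) + \<alpha> * \<rho> * Eu * b *
      (\<beta> n * (K n)\<^sup>2 + (K n + 1) * K n * (\<Sum>i\<in>{1..N} - {n}. \<beta> i * K i / (K i + 1)))) at_top"
      unfolding T_def
      by (intro tendsto_add tendsto_mult tendsto_const tendsto_sum Delta3_divide_tendsto_0
          Delta4_tendsto K)
  qed auto
  have inv: "((\<lambda>M::real. C / M) \<longlongrightarrow> 0) at_top" for C :: real
    by (intro tendsto_divide_0[OF tendsto_const] filterlim_ident filterlim_at_top_imp_at_infinity)
  have \<eta>0: "(\<eta> \<longlongrightarrow> 0) at_top"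
    unfolding \<eta>_def by (rule eta_tendsto_0)
  have M\<eta>: "((\<lambda>M. M * \<eta> M) \<longlongrightarrow> \<tau> * Eu * \<beta> n) at_top"
    unfolding \<eta>_def by (rule mult_eta_tendsto)
  \<comment> \<open>Finiteness is enough: \<open>S\<close> occurs only with the factor
    \<open>Eu / M\<close>.\<close>
  obtain s where s: "(S \<longlongrightarrow> s) at_top"
  proof
    show "(S \<longlongrightarrow> (\<Sum>i\<in>{1..N}. \<beta> i / (K i + 1))) at_top"
      unfolding S_def by (intro tendsto_sum sigma_sq_tendsto K)
  qed
  have A_eq: "A M = Eu / M * \<beta> n * ((c * M)\<^sup>2 * (K n + \<eta> M)\<^sup>2 +
      (a + \<alpha>\<^sup>2 * b) * M * ((\<eta> M)\<^sup>2 + 2 * K n * \<eta> M))" for M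
    unfolding A_def rate_num_def \<eta>_def c_def by (simp add: algebra_simps)
  have B_eq: "B M = c * M * (K n + \<eta> M) * (K n + 1) * (1 + Eu / M * S M) + T M" if "M > 0" for M
  proof -
    have "a * M + \<alpha> * (b * M) = c * M"
      unfolding c_def by algebra
    then show ?thesis
      using that unfolding B_def rate_den_def \<eta>_def S_def T_def sum_divide_distrib[symmetric]
      by simp
  qed
  have c: "c > 0"
    using ab by (simp add: c_def)
  have "((\<lambda>M. A M / B M) \<longlongrightarrow> c * Eu * \<beta> n * K n / (K n + 1)) at_top"
  proof (cases "K n = 0")
    case True
    \<comment> \<open>Numerator and denominator themselves, regrouped so that each growing factor
      \<open>M\<close> is paired with an \<open>\<eta> M\<close>. Then \<open>?g\<close> tends to 0
      and \<open>?h\<close> to \<open>c * (\<tau> * Eu * \<beta> n) > 0\<close>.\<close>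
    let ?g = "\<lambda>M. Eu / M * \<beta> n * (c\<^sup>2 * (M * \<eta> M)\<^sup>2 + (a + \<alpha>\<^sup>2 * b) * (M * \<eta> M) * \<eta> M)"
    let ?h = "\<lambda>M. c * (M * \<eta> M) * (1 + Eu / M * S M) + T M"
    have "((\<lambda>M. ?g M / ?h M) \<longlongrightarrow>
        0 * \<beta> n * (c\<^sup>2 * (\<tau> * Eu * \<beta> n)\<^sup>2 + (a + \<alpha>\<^sup>2 * b) * (\<tau> * Eu * \<beta> n) * 0) /
        (c * (\<tau> * Eu * \<beta> n) * (1 + 0 * s) + 0)) at_top"
      using D D0[OF True] c Eu \<tau> \<beta> by (intro tendsto_intros inv M\<eta> \<eta>0 s) simp_all
    moreover have "\<forall>\<^sub>F M in at_top. ?g M / ?h M = A M / B M"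
      using eventually_gt_at_top[of 0]
    proof eventually_elim
      case (elim M)
      have "A M = ?g M"
        unfolding A_eq True by (simp add: algebra_simps power2_eq_square)
      moreover have "B M = ?h M"
        unfolding B_eq[OF elim] True by simp
      ultimately show ?case
        by simp
    qed
    ultimately show ?thesis
      by (rule tendsto_eq_rhs[OF Lim_transform_eventually]) (simp add: True)
  next
    case False
    with K[OF n] have Kn: "K n > 0"
      by simp
    \<comment> \<open>Numerator and denominator divided by \<open>M\<close>; both now have finite
      limits, the second one positive.\<close>
    let ?g = "\<lambda>M. Eu * \<beta> n * (c\<^sup>2 * (K n + \<eta> M)\<^sup>2 + (a + \<alpha>\<^sup>2 * b) / M * ((\<eta> M)\<^sup>2 + 2 * K n * \<eta> M))"
    let ?h = "\<lambda>M. c * (K n + \<eta> M) * (K n + 1) * (1 + Eu / M * S M) + 1 / M * T M"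
    have "((\<lambda>M. ?g M / ?h M) \<longlongrightarrow>
        Eu * \<beta> n * (c\<^sup>2 * (K n + 0)\<^sup>2 + 0 * (0\<^sup>2 + 2 * K n * 0)) /
        (c * (K n + 0) * (K n + 1) * (1 + 0 * s) + 0 * D)) at_top"
      using c Kn by (intro tendsto_intros inv \<eta>0 s D) simp_all
    moreover have "\<forall>\<^sub>F M in at_top. ?g M / ?h M = A M / B M"
      using eventually_gt_at_top[of 0]
    proof eventually_elim
      case (elim M)
      have "A M = M * ?g M"
        unfolding A_eq using elim by (simp add: field_simps power2_eq_square)
      moreover have "B M = M * ?h M"
        unfolding B_eq[OF elim] using elim by (simp add: distrib_left mult_ac)
      ultimately show ?case
        using elim by simp
    qed
    moreover have "Eu * \<beta> n * (c\<^sup>2 * (K n + 0)\<^sup>2 + 0 * (0\<^sup>2 + 2 * K n * 0)) /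
        (c * (K n + 0) * (K n + 1) * (1 + 0 * s) + 0 * D) = c * Eu * \<beta> n * K n / (K n + 1)"
      using c Kn by (simp add: divide_simps power2_eq_square)
    ultimately show ?thesis
      by (rule tendsto_eq_rhs[OF Lim_transform_eventually])
  qed
  then show ?thesis
    by (simp add: A_def B_def c_def)
qed

lemma rate_limit_tendsto:
  assumes "Eu * b * (\<rho> * \<kappa> + \<alpha>) \<ge> 0"
  shows "((\<lambda>x. rate_limit \<rho> \<alpha> \<kappa> Eu b x) \<longlongrightarrow> log 2 (1 + Eu * b * (\<rho> * \<kappa> + \<alpha>))) at_top"
proof -
  let ?C = "Eu * b * (\<rho> * \<kappa> + \<alpha>)"
  have lim: "((\<lambda>x::real. 1 / x) \<longlongrightarrow> 0) at_top"
    by (intro tendsto_divide_0[OF tendsto_const] filterlim_ident filterlim_at_top_imp_at_infinity)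
  \<comment> \<open>Writing \<open>x / (x + 1)\<close> as \<open>1 / (1 + 1 / x)\<close> makes the
    limit a substitution; \<open>?C \<ge> 0\<close> keeps the argument of the logarithm positive
    there.\<close>
  have "((\<lambda>x. log 2 (1 + ?C / (1 + 1 / x))) \<longlongrightarrow> log 2 (1 + ?C / (1 + 0))) at_top"
    using assms by (intro tendsto_intros lim) auto
  moreover have "\<forall>\<^sub>F x in at_top. log 2 (1 + ?C / (1 + 1 / x)) = rate_limit \<rho> \<alpha> \<kappa> Eu b x"
    using eventually_gt_at_top[of 0]
  proof eventually_elim
    case (elim x)
    then have "?C / (1 + 1 / x) = (\<rho> * \<kappa> + \<alpha>) * Eu * b * x / (x + 1)"
      by (simp add: field_simps)
    then show ?case
      by (simp add: rate_limit_def)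
  qed
  ultimately show ?thesis
    by (rule tendsto_eq_rhs[OF Lim_transform_eventually]) simp
qed

text \<open>Serves both monotonicity claims, since the limit rate depends on \<open>\<rho>\<close>,
  \<open>\<kappa>\<close> and \<open>\<alpha>\<close> only through
  \<open>\<rho> * \<kappa> + \<alpha>\<close>.\<close>

lemma rate_limit_le:
  assumes "0 \<le> \<rho> * \<kappa> + \<alpha>" "\<rho> * \<kappa> + \<alpha> \<le> \<rho>' * \<kappa>' + \<alpha>'" "Eu \<ge> 0" "b \<ge> 0" "x \<ge> 0"
  shows "rate_limit \<rho> \<alpha> \<kappa> Eu b x \<le> rate_limit \<rho>' \<alpha>' \<kappa>' Eu b x"
proof -
  have "0 \<le> (\<rho> * \<kappa> + \<alpha>) * Eu * b * x / (x + 1)"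
    using assms by simp
  moreover have "(\<rho> * \<kappa> + \<alpha>) * Eu * b * x / (x + 1) \<le> (\<rho>' * \<kappa>' + \<alpha>') * Eu * b * x / (x + 1)"
    using assms by (intro divide_right_mono mult_right_mono) auto
  ultimately show ?thesis
    unfolding rate_limit_def by simp
qed

theorem mainTheorem4:
  fixes N n :: nat
    and k d \<rho> \<alpha> Eu \<tau> \<kappa> :: real
    and \<beta> K \<theta> :: "nat \<Rightarrow> real"
  assumes "N \<ge> 1" and "n \<in> {1..N}"
    and "0 \<le> \<rho>" and "\<rho> < 1" and "\<alpha> = 1 - \<rho>"
    and "\<And>i. i \<in> {1..N} \<Longrightarrow> \<beta> i > 0"
    and "\<And>i. i \<in> {1..N} \<Longrightarrow> K i \<ge> 0"
    and "k > 0" and "d > 0"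
    and "\<And>i. i \<in> {1..N} - {n} \<Longrightarrow> sin (k * d * (sin (\<theta> n) - sin (\<theta> i)) / 2) \<noteq> 0"
    and "Eu > 0" and "\<tau> > 0" and "0 \<le> \<kappa>" and "\<kappa> \<le> 1"
  shows "((\<lambda>M::real. rate_IP N k d \<theta> \<rho> \<alpha> (\<kappa> * M) ((1 - \<kappa>) * M) (Eu / M) (\<tau> * (Eu / M)) \<beta> K n)
            \<longlongrightarrow> rate_limit \<rho> \<alpha> \<kappa> Eu (\<beta> n) (K n)) at_top
       \<and> ((\<lambda>x. rate_limit \<rho> \<alpha> \<kappa> Eu (\<beta> n) x)
            \<longlongrightarrow> log 2 (1 + Eu * \<beta> n * (\<rho> * \<kappa> + \<alpha>))) at_top
       \<and> mono_on {0..1} (\<lambda>\<kappa>'. rate_limit \<rho> \<alpha> \<kappa>' Eu (\<beta> n) (K n))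
       \<and> mono_on {0<..1} (\<lambda>\<alpha>'. rate_limit (1 - \<alpha>') \<alpha>' \<kappa> Eu (\<beta> n) (K n))"
proof (intro conjI)
  have \<alpha>: "\<alpha> > 0" and \<beta>: "\<beta> n > 0" and K: "K n \<ge> 0"
    using assms by auto
  \<comment> \<open>Matches the coefficient \<open>a + \<alpha> * b\<close> of
    \<open>rate_ratio_tendsto\<close>, at \<open>a = \<kappa>\<close> and
    \<open>b = 1 - \<kappa>\<close>, with the one in \<open>rate_limit\<close>.\<close>
  have \<alpha>_eq: "\<kappa> + \<alpha> * (1 - \<kappa>) = \<rho> * \<kappa> + \<alpha>"
    unfolding \<open>\<alpha> = 1 - \<rho>\<close> by algebra
  have pos: "\<rho> * \<kappa> + \<alpha> > 0"
    using \<alpha> assms by (intro add_nonneg_pos) auto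
  \<comment> \<open>Puts the limit of the logarithm's argument at 1 or above, where the logarithm is
    continuous.\<close>
  have "0 \<le> (\<rho> * \<kappa> + \<alpha>) * Eu * \<beta> n * K n / (K n + 1)"
    using pos \<beta> K \<open>Eu > 0\<close> by simp
  then show "((\<lambda>M::real. rate_IP N k d \<theta> \<rho> \<alpha> (\<kappa> * M) ((1 - \<kappa>) * M) (Eu / M) (\<tau> * (Eu / M)) \<beta> K n)
      \<longlongrightarrow> rate_limit \<rho> \<alpha> \<kappa> Eu (\<beta> n) (K n)) at_top"
    unfolding rate_IP_def rate_limit_def \<alpha>_eq[symmetric]
    using assms \<beta> pos[folded \<alpha>_eq]
    by (intro tendsto_log tendsto_add tendsto_const rate_ratio_tendsto) auto
  show "((\<lambda>x. rate_limit \<rho> \<alpha> \<kappa> Eu (\<beta> n) x)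
      \<longlongrightarrow> log 2 (1 + Eu * \<beta> n * (\<rho> * \<kappa> + \<alpha>))) at_top"
    using pos \<beta> \<open>Eu > 0\<close> by (intro rate_limit_tendsto) simp
  show "mono_on {0..1} (\<lambda>\<kappa>'. rate_limit \<rho> \<alpha> \<kappa>' Eu (\<beta> n) (K n))"
    using \<alpha> \<beta> K \<open>0 \<le> \<rho>\<close> \<open>Eu > 0\<close>
    by (intro mono_onI rate_limit_le) (auto intro: mult_left_mono)
  show "mono_on {0<..1} (\<lambda>\<alpha>'. rate_limit (1 - \<alpha>') \<alpha>' \<kappa> Eu (\<beta> n) (K n))"
  proof (intro mono_onI rate_limit_le)
    fix r s :: real
    assume rs: "r \<in> {0<..1}" "s \<in> {0<..1}" "r \<le> s"
    then show "0 \<le> (1 - r) * \<kappa> + r"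
      using assms by simp
    \<comment> \<open>This product is the difference of the two sides of the next
      inequality.\<close>
    have "(s - r) * (1 - \<kappa>) \<ge> 0"
      using rs assms by simp
    then show "(1 - r) * \<kappa> + r \<le> (1 - s) * \<kappa> + s"
      by (simp add: algebra_simps)
  qed (use \<beta> K \<open>Eu > 0\<close> in auto)
qed

end
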